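(* Let $p_i=(x_i,y_i)$, $i=1,\dots,4$, be points of $[0,1)^2$, let $(\mathbb{Z}^2,p)$ be the periodic quadrilateral grid framework determined by them, and write $x_{ij}=x_i-x_j$, $y_{ij}=y_i-y_j$. The matricial symbol function $\Phi(z,w)$ of $(\mathbb{Z}^2,p)$ for the four-vertex motif is the matrix function on $\mathbb{T}^2$ given by $$\begin{bmatrix} x_{12}&y_{12}&-x_{12}&-y_{12}&0&0&0&0\\ 0&0&x_{23}&y_{23}&-x_{23}&-y_{23}&0&0\\ 0&0&0&0&x_{34}&y_{34}&-x_{34}&-y_{34}\\ -x_{41}&-y_{41}&0&0&0&0&x_{41}&y_{41}\\ x_{12}+1&y_{12}&-(x_{12}+1)z&-y_{12}z&0&0&0&0\\ 0&0&x_{23}&y_{23}+1&-x_{23}w&-(y_{23}+1)w&0&0\\ 0&0&0&0&x_{34}-1&y_{34}&(1-x_{34})\bar z&-y_{34}\bar z\\ -x_{41}\bar w&(1-y_{41})\bar w&0&0&0&0&x_{41}&y_{41}-1\end{bmatrix}.$$ Furthermore, if the four points in the unit cell have algebraically independent coordinates then $(\mathbb{Z}^2,p)$ is square-summably isostatic.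
   Context: The periodic quadrilateral grid framework determined by $p_1,\dots,p_4\in[0,1)^2$ has framework points $p_t+(i,j)$, $1\le t\le4$, $(i,j)\in\mathbb{Z}^2$, and edges the $\mathbb{Z}^2$-translates of the eight motif edges, in order: $e^1=[p_1,p_2]$, $e^2=[p_2,p_3]$, $e^3=[p_3,p_4]$, $e^4=[p_4,p_1]$, $e^5=[p_2+(-1,0),p_1]$, $e^6=[p_3+(0,-1),p_2]$, $e^7=[p_4+(1,0),p_3]$, $e^8=[p_1+(0,1),p_4]$. The motif vertices are $p_1,\dots,p_4$. The rigidity matrix $R$ acts by $(Ru)_e=(p_v-p_w)\cdot(u_v-u_w)$ for an edge $e=vw$. The matricial symbol function $\Phi(z,w)$ on $\mathbb{T}^2$ of the motif has rows indexed by the motif edges and columns by the $x,y$ coordinates of motif vertices in order ($p_1^x,p_1^y,\dots,p_4^x,p_4^y$): for a motif edge $e$ joining an (unshifted) motif vertex $p_s$ and a vertex $p_t+(i,j)$, with $v_e=p_s-p_t-(i,j)$, row $e$ has entries $v_e$ in the columns of $p_s$, $-\bar z^i\bar w^jv_e$ in the columns of $p_t$, and zero elsewhere (for the internal edges the order of endpoints is as listed). Algebraically independent means over $\mathbb{Q}$. Square-summably isostatic: there is no nonzero square-summable $u=(u_v)_v$ with $Ru=0$ and no nonzero square-summable $s=(s_e)_e$ with $R^ts=0$, where $R^t$ is the transpose. *)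

theory Defs
  imports "HOL-Analysis.Analysis" "HOL-Library.Poly_Mapping"
begin

text \<open>
  A polynomial over the rationals in variables indexed by \<open>'i\<close> is a finitely supported map from
  monomials \<open>'i \<Rightarrow>\<^sub>0 nat\<close> to coefficients.
\<close>

definition poly_eval :: "('i \<Rightarrow> real) \<Rightarrow> (('i \<Rightarrow>\<^sub>0 nat) \<Rightarrow>\<^sub>0 rat) \<Rightarrow> real" where
  "poly_eval a P =
     (\<Sum>m\<in>Poly_Mapping.keys P.
        of_rat (Poly_Mapping.lookup P m) *
        (\<Prod>i\<in>Poly_Mapping.keys m. a i ^ Poly_Mapping.lookup m i))"

definition algebraically_independent :: "('i \<Rightarrow> real) \<Rightarrow> bool" where
  "algebraically_independent a \<longleftrightarrow> (\<forall>P. poly_eval a P = 0 \<longrightarrow> P = 0)"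


text \<open>
  A framework is a placement \<open>q\<close> of the vertices together with a map \<open>ends\<close> that sends every edge to
  its two end vertices. The order of the two ends is immaterial for the rigidity matrix.
\<close>

definition rigidity_map ::
  "('v \<Rightarrow> real^2) \<Rightarrow> ('e \<Rightarrow> 'v \<times> 'v) \<Rightarrow> ('v \<Rightarrow> real^2) \<Rightarrow> 'e \<Rightarrow> real" where
  "rigidity_map q ends u e =
     (let (v, w) = ends e in (q v - q w) \<bullet> (u v - u w))"

definition incident :: "('e \<Rightarrow> 'v \<times> 'v) \<Rightarrow> 'v \<Rightarrow> 'e \<Rightarrow> bool" where
  "incident ends v e \<longleftrightarrow> v \<in> {fst (ends e), snd (ends e)}"

text \<open>The two entries of the rigidity matrix in row \<open>e\<close> and in the columns of the vertex \<open>v\<close>.\<close>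

definition rigidity_block ::
  "('v \<Rightarrow> real^2) \<Rightarrow> ('e \<Rightarrow> 'v \<times> 'v) \<Rightarrow> 'e \<Rightarrow> 'v \<Rightarrow> real^2" where
  "rigidity_block q ends e v =
     (let (a, b) = ends e in
      if v = a then q a - q b else if v = b then q b - q a else 0)"

lemma rigidity_map_eq_matrix:
  "rigidity_map q ends u e =
     (\<Sum>v | incident ends v e. rigidity_block q ends e v \<bullet> u v)"
proof -
  obtain a b where ab: "ends e = (a, b)" by (cases "ends e")
  have "{v. incident ends v e} = {a, b}"
    by (auto simp: incident_def ab)
  then show ?thesis
    by (cases "a = b")
       (simp_all add: rigidity_map_def rigidity_block_def ab inner_diff_left inner_diff_right)
qed

text \<open>
  For a vertex with infinitely many incident edges the sum below would be 0 by convention;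
  lemma \<open>finite_incident_grid\<close> rules this out for the grid framework.
\<close>

definition rigidity_transpose ::
  "('v \<Rightarrow> real^2) \<Rightarrow> ('e \<Rightarrow> 'v \<times> 'v) \<Rightarrow> ('e \<Rightarrow> real) \<Rightarrow> 'v \<Rightarrow> real^2" where
  "rigidity_transpose q ends s v =
     (\<Sum>e | incident ends v e. s e *\<^sub>R rigidity_block q ends e v)"

definition square_summable :: "('a \<Rightarrow> 'b::real_normed_vector) \<Rightarrow> bool" where
  "square_summable f \<longleftrightarrow> (\<lambda>x. (norm (f x))\<^sup>2) summable_on UNIV"

definition square_summably_isostatic ::
  "('v \<Rightarrow> real^2) \<Rightarrow> ('e \<Rightarrow> 'v \<times> 'v) \<Rightarrow> bool" where
  "square_summably_isostatic q ends \<longleftrightarrow>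
     \<not> (\<exists>u. square_summable u \<and> u \<noteq> (\<lambda>_. 0) \<and> rigidity_map q ends u = (\<lambda>_. 0)) \<and>
     \<not> (\<exists>s. square_summable s \<and> s \<noteq> (\<lambda>_. 0) \<and> rigidity_transpose q ends s = (\<lambda>_. 0))"


text \<open>
  The types \<open>4\<close> and \<open>8\<close> index the motif vertices and the motif edges. They are residue types, so
  their elements are \<open>1, \<dots>, 4\<close> and \<open>1, \<dots>, 8\<close>, with \<open>4 = 0\<close> and \<open>8 = 0\<close> respectively.
  The vertex \<open>(t, i, j)\<close> is the framework point \<open>p\<^sub>t + (i, j)\<close>.
\<close>

type_synonym grid_vertex = "4 \<times> int \<times> int"
type_synonym grid_edge = "8 \<times> int \<times> int"

text \<open>
  A motif edge \<open>(s, t, i, j)\<close> joins the unshifted motif vertex \<open>p\<^sub>s\<close> to \<open>p\<^sub>t + (i, j)\<close>.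
\<close>

definition motif_edges :: "(4 \<times> 4 \<times> int \<times> int)^8" where
  "motif_edges = vector
     [(1, 2,  0,  0),
      (2, 3,  0,  0),
      (3, 4,  0,  0),
      (4, 1,  0,  0),
      (1, 2, -1,  0),
      (2, 3,  0, -1),
      (3, 4,  1,  0),
      (4, 1,  0,  1)]"

definition grid_point :: "(4 \<Rightarrow> real^2) \<Rightarrow> grid_vertex \<Rightarrow> real^2" where
  "grid_point p = (\<lambda>(t, i, j). p t + vector [of_int i, of_int j])"

text \<open>The edge \<open>(e, k, l)\<close> is the translate of the motif edge \<open>e\<close> by \<open>(k, l)\<close>.\<close>

definition grid_ends :: "grid_edge \<Rightarrow> grid_vertex \<times> grid_vertex" where
  "grid_ends = (\<lambda>(e, k, l).
     let (s, t, i, j) = motif_edges $ e in ((s, k, l), (t, i + k, j + l)))"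

lemma finite_incident_grid: "finite {e. incident grid_ends v e}"
proof -
  obtain a k l where v: "v = (a, k, l)" by (metis prod_cases3)
  have "{e. incident grid_ends v e} \<subseteq>
          (\<Union>e. {(e, k, l)} \<union> (case motif_edges $ e of (s, t, i, j) \<Rightarrow> {(e, k - i, l - j)}))"
    by (auto simp: incident_def grid_ends_def v split: prod.splits)
  then show ?thesis
    by (rule finite_subset) (auto split: prod.splits)
qed


text \<open>The columns of the symbol, as motif vertex and coordinate (1 for \<open>x\<close>, 2 for \<open>y\<close>).\<close>

definition symbol_column :: "(4 \<times> 2)^8" where
  "symbol_column = vector
     [(1, 1), (1, 2), (2, 1), (2, 2), (3, 1), (3, 2), (4, 1), (4, 2)]"

definition grid_symbol :: "(4 \<Rightarrow> real^2) \<Rightarrow> complex \<Rightarrow> complex \<Rightarrow> complex^8^8" where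
  "grid_symbol p z w = (\<chi> e c.
     let (s, t, i, j) = motif_edges $ e;
         (a, k) = symbol_column $ c;
         d = p s - p t - vector [of_int i, of_int j]
     in if a = s then of_real (d $ k)
        else if a = t then - ((cnj z powi i) * (cnj w powi j) * of_real (d $ k))
        else 0)"

end

theory Submission
  imports Defs
begin

text \<open>
  Combinatorially the framework is the square lattice: a cell is a block of two by two vertices, with
  \<open>p\<^sub>1\<close>, \<open>p\<^sub>2\<close>, \<open>p\<^sub>3\<close>, \<open>p\<^sub>4\<close> at lower left, lower right, upper right and upper left, and each vertex has
  one edge to the left, right, above and below. The formula for the symbol is a computation of its
  entries. Square-summable isostaticity rests on two facts.

  Propagation. The velocity of a vertex is determined by those of its left and lower neighbours as
  soon as the edges to them are not parallel; likewise the stresses in the right and upper edge at a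
  vertex are determined by those in the left and lower edge as soon as the first two are not
  parallel. For the four types of vertices this makes eight cross products that must not vanish. Each
  is an integer polynomial in the coordinates of the motif and is nonzero for the square grid of
  mesh 1/2, hence it is nonzero at algebraically independent coordinates
  (\<open>cross_motif_edges_nonzero\<close>). So a flex or a stress that is zero in the cells to the left of and
  below a given cell is zero in that cell.

  Counting dimensions. By propagation, the restrictions of the flexes (or of the stresses) to a box
  of \<open>n\<^sup>2\<close> cells form a space of dimension \<open>O(n)\<close>. A nonzero square-summable flex would have some nonzero
  entry, and its translates would put this entry at the corresponding place of every cell of the box
  with norms bounded independently of \<open>n\<close>. The matrix whose rows are these translates has trace of
  order \<open>n\<^sup>2\<close> and squared Hilbert--Schmidt norm \<open>O(n\<^sup>2)\<close>, and therefore rank of order at least \<open>n\<^sup>2\<close>,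
  which is impossible for large \<open>n\<close>. This is
  \<open>corner_determined_imp_square_summable_zero\<close>.
\<close>

section \<open>Square-summable elements of translation-invariant spaces\<close>

lemma lin_comb_minus_sum:
  fixes K :: "('i \<Rightarrow> real) set"
  assumes lin: "\<And>f g a b. f \<in> K \<Longrightarrow> g \<in> K \<Longrightarrow> (\<lambda>x. a * f x + b * g x) \<in> K"
    and "v \<in> K" and b: "\<And>i. i < m \<Longrightarrow> b i \<in> K"
  shows "(\<lambda>x. v x - (\<Sum>i<m::nat. c i * b i x)) \<in> K"
  using b
proof (induction m)
  case 0
  then show ?case using \<open>v \<in> K\<close> by simp
next
  case (Suc m)
  then have "(\<lambda>x. 1 * (v x - (\<Sum>i<m. c i * b i x)) + (- c m) * b m x) \<in> K"
    by (intro lin) auto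
  then show ?case by (simp add: algebra_simps)
qed

text \<open>
  A space of functions that is determined on \<open>F\<close> by its values on \<open>S\<close> has dimension at most \<open>card S\<close>
  on \<open>F\<close>; the basis of its restrictions to \<open>F\<close> is built by Gram--Schmidt orthogonalization along an
  induction on \<open>S\<close>. Removing a point \<open>s\<close> from \<open>S\<close> amounts to passing to the functions that vanish
  at \<open>s\<close>, and this costs at most one basis vector.
\<close>

lemma orthonormal_basis_of_determined_space:
  fixes K :: "('i \<Rightarrow> real) set"
  assumes "finite S" and F: "finite F"
    and lin: "\<And>f g a b. f \<in> K \<Longrightarrow> g \<in> K \<Longrightarrow> (\<lambda>x. a * f x + b * g x) \<in> K"
    and det: "\<And>v x. v \<in> K \<Longrightarrow> \<forall>s\<in>S. v s = 0 \<Longrightarrow> x \<in> F \<Longrightarrow> v x = 0"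
  shows "\<exists>m\<le>card S. \<exists>b. (\<forall>i<m. b i \<in> K) \<and>
    (\<forall>i<m. \<forall>j<m. (\<Sum>y\<in>F. b i y * b j y) = (if i = j then 1 else 0)) \<and>
    (\<forall>v\<in>K. \<forall>x\<in>F. v x = (\<Sum>i<m. (\<Sum>y\<in>F. v y * b i y) * b i x))"
  using \<open>finite S\<close> lin det
proof (induction S arbitrary: K)
  case empty
  then show ?case by (intro exI[of _ 0]) auto
next
  case (insert s S K)
  note lin = insert.prems(1)
  define K' where "K' = {v \<in> K. v s = 0}"
  have "\<exists>m\<le>card S. \<exists>b. (\<forall>i<m. b i \<in> K') \<and>
    (\<forall>i<m. \<forall>j<m. (\<Sum>y\<in>F. b i y * b j y) = (if i = j then 1 else 0)) \<and>
    (\<forall>v\<in>K'. \<forall>x\<in>F. v x = (\<Sum>i<m. (\<Sum>y\<in>F. v y * b i y) * b i x))"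
    by (rule insert.IH) (use insert.prems in \<open>auto simp: K'_def\<close>)
  then obtain m b where m: "m \<le> card S" and bK': "\<And>i. i < m \<Longrightarrow> b i \<in> K'"
    and orth: "\<And>i j. i < m \<Longrightarrow> j < m \<Longrightarrow> (\<Sum>y\<in>F. b i y * b j y) = (if i = j then 1 else 0)"
    and expand: "\<And>v x. v \<in> K' \<Longrightarrow> x \<in> F \<Longrightarrow> v x = (\<Sum>i<m. (\<Sum>y\<in>F. v y * b i y) * b i x)"
    by blast
  have bK: "b i \<in> K" if "i < m" for i using bK'[OF that] by (simp add: K'_def)
  show ?case
  proof (cases "\<forall>v\<in>K. \<forall>x\<in>F. v x = (\<Sum>i<m. (\<Sum>y\<in>F. v y * b i y) * b i x)")
    case True
    then show ?thesis
      using m bK orth insert.hyps by (intro exI[of _ m] conjI exI[of _ b]) auto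
  next
    case False
    then obtain v x0 where v: "v \<in> K" and x0: "x0 \<in> F"
      and neq: "v x0 \<noteq> (\<Sum>i<m. (\<Sum>y\<in>F. v y * b i y) * b i x0)"
      by blast
    define r where "r = (\<lambda>x. v x - (\<Sum>i<m. (\<Sum>y\<in>F. v y * b i y) * b i x))"
    have rK: "r \<in> K" unfolding r_def by (rule lin_comb_minus_sum[OF lin v bK])
    have r_orth: "(\<Sum>y\<in>F. r y * b j y) = 0" if "j < m" for j
    proof -
      define c where "c = (\<lambda>i. \<Sum>y\<in>F. v y * b i y)"
      have "(\<Sum>y\<in>F. (\<Sum>i<m. c i * b i y) * b j y)
          = (\<Sum>y\<in>F. \<Sum>i<m. c i * (b i y * b j y))"
        by (simp add: sum_distrib_right mult.assoc)
      also have "\<dots> = (\<Sum>i<m. \<Sum>y\<in>F. c i * (b i y * b j y))"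
        by (rule sum.swap)
      also have "\<dots> = (\<Sum>i<m. c i * (\<Sum>y\<in>F. b i y * b j y))"
        by (simp add: sum_distrib_left)
      also have "\<dots> = (\<Sum>i<m. if i = j then c i else 0)"
        using that by (intro sum.cong) (auto simp: orth)
      also have "\<dots> = c j" using that by simp
      finally have "(\<Sum>y\<in>F. r y * b j y) = (\<Sum>y\<in>F. v y * b j y) - c j"
        by (simp add: r_def c_def left_diff_distrib sum_subtractf)
      then show ?thesis by (simp add: c_def)
    qed
    \<comment> \<open>otherwise \<open>r\<close> would lie in \<open>K'\<close> and at the same time be orthogonal to its basis\<close>
    have rs: "r s \<noteq> 0"
    proof
      assume "r s = 0"
      then have "r x0 = (\<Sum>i<m. (\<Sum>y\<in>F. r y * b i y) * b i x0)"
        using rK x0 by (intro expand) (auto simp: K'_def)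
      then have "r x0 = 0" by (simp add: r_orth)
      then show False using neq by (simp add: r_def)
    qed
    define N where "N = sqrt (\<Sum>y\<in>F. r y * r y)"
    have "(\<Sum>y\<in>F. r y * r y) > 0"
    proof (rule sum_pos2[OF F x0])
      show "0 < r x0 * r x0" using neq by (auto simp: r_def zero_less_mult_iff linorder_neq_iff)
    qed auto
    then have N: "N > 0" "(\<Sum>y\<in>F. r y * r y) = N * N" by (auto simp: N_def)
    define e where "e = (\<lambda>x. r x / N)"
    have eK: "e \<in> K"
      using lin[OF rK rK, of "1 / N" 0] by (simp add: e_def)
    have es: "e s \<noteq> 0" using rs N by (simp add: e_def)
    have e_orth: "(\<Sum>y\<in>F. e y * b j y) = 0" "(\<Sum>y\<in>F. b j y * e y) = 0" if "j < m" for j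
      using r_orth[OF that] by (simp_all add: e_def mult.commute flip: sum_divide_distrib)
    have ee: "(\<Sum>y\<in>F. e y * e y) = 1"
      using N by (simp add: e_def flip: sum_divide_distrib)
    define b' where "b' = b(m := e)"
    have b'_simps: "b' m = e" "\<And>i. i < m \<Longrightarrow> b' i = b i" by (auto simp: b'_def)
    have "w x = (\<Sum>i<Suc m. (\<Sum>y\<in>F. w y * b' i y) * b' i x)" if w: "w \<in> K" and x: "x \<in> F" for w x
    proof -
      define t where "t = w s / e s"
      have w'K: "(\<lambda>y. w y - t * e y) \<in> K'"
        using lin[OF w eK, of 1 "- t"] es by (simp add: K'_def t_def)
      have coeff: "(\<Sum>y\<in>F. (w y - t * e y) * b i y) = (\<Sum>y\<in>F. w y * b i y)" if "i < m" for i
        using e_orth(1)[OF that]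
        by (simp add: left_diff_distrib sum_subtractf mult.assoc flip: sum_distrib_left)
      have split: "w z = t * e z + (\<Sum>i<m. (\<Sum>y\<in>F. w y * b i y) * b i z)" if "z \<in> F" for z
        using expand[OF w'K that] coeff by simp
      define c where "c = (\<lambda>i. \<Sum>y\<in>F. w y * b i y)"
      have "(\<Sum>y\<in>F. w y * e y) = (\<Sum>y\<in>F. t * (e y * e y) + (\<Sum>i<m. c i * (b i y * e y)))"
      proof (intro sum.cong refl)
        fix y assume "y \<in> F"
        then have "w y * e y = (t * e y + (\<Sum>i<m. c i * b i y)) * e y"
          using split[of y] by (simp add: c_def)
        then show "w y * e y = t * (e y * e y) + (\<Sum>i<m. c i * (b i y * e y))"
          by (simp add: distrib_right sum_distrib_right mult.assoc)
      qed
      also have "\<dots> = t * (\<Sum>y\<in>F. e y * e y) + (\<Sum>i<m. \<Sum>y\<in>F. c i * (b i y * e y))"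
        by (simp add: sum.distrib sum_distrib_left sum.swap[of _ "{..<m}" F])
      also have "\<dots> = t" by (simp add: ee e_orth(2) flip: sum_distrib_left)
      finally show ?thesis using split[OF x] by (simp add: b'_simps)
    qed
    moreover have "(\<Sum>y\<in>F. b' i y * b' j y) = (if i = j then 1 else 0)"
      if "i < Suc m" "j < Suc m" for i j
      using that orth e_orth ee by (auto simp: less_Suc_eq b'_simps)
    moreover have "\<forall>i<Suc m. b' i \<in> K" using bK eK by (auto simp: less_Suc_eq b'_simps)
    moreover have "Suc m \<le> card (insert s S)" using m insert.hyps by simp
    ultimately show ?thesis by blast
  qed
qed

text \<open>
  This is the bound of a trace by rank and Hilbert--Schmidt norm in the form needed here. With an
  orthonormal basis \<open>b\<close>, the Cauchy--Schwarz inequality gives \<open>(v x)\<^sup>2 \<le> \<parallel>v\<parallel>\<^sup>2 * (\<Sum>i. (b i x)\<^sup>2)\<close> for each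
  \<open>v\<close> in the space, and the last factors sum over \<open>x\<close> to the dimension.
\<close>

lemma sum_diagonal_squares_le:
  fixes K :: "('i \<Rightarrow> real) set"
  assumes S: "finite S" and F: "finite F"
    and lin: "\<And>f g a b. f \<in> K \<Longrightarrow> g \<in> K \<Longrightarrow> (\<lambda>x. a * f x + b * g x) \<in> K"
    and det: "\<And>v x. v \<in> K \<Longrightarrow> \<forall>s\<in>S. v s = 0 \<Longrightarrow> x \<in> F \<Longrightarrow> v x = 0"
    and g: "\<And>x. x \<in> F \<Longrightarrow> g x \<in> K"
    and bound: "\<And>x. x \<in> F \<Longrightarrow> (\<Sum>y\<in>F. (g x y)\<^sup>2) \<le> C"
    and C: "0 \<le> C"
  shows "(\<Sum>x\<in>F. (g x x)\<^sup>2) \<le> C * card S"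
proof -
  obtain m b where m: "m \<le> card S"
    and orth: "\<And>i j. i < m \<Longrightarrow> j < m \<Longrightarrow> (\<Sum>y\<in>F. b i y * b j y) = (if i = j then 1 else 0)"
    and expand: "\<And>v x. v \<in> K \<Longrightarrow> x \<in> F \<Longrightarrow> v x = (\<Sum>i<m::nat. (\<Sum>y\<in>F. v y * b i y) * b i x)"
  proof -
    have "\<exists>m\<le>card S. \<exists>b. (\<forall>i<m. b i \<in> K) \<and>
      (\<forall>i<m. \<forall>j<m. (\<Sum>y\<in>F. b i y * b j y) = (if i = j then 1 else 0)) \<and>
      (\<forall>v\<in>K. \<forall>x\<in>F. v x = (\<Sum>i<m. (\<Sum>y\<in>F. v y * b i y) * b i x))"
      by (rule orthonormal_basis_of_determined_space[OF S F]) (use lin det in auto)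
    then show ?thesis using that by blast
  qed
  have eval: "(g x x)\<^sup>2 \<le> C * (\<Sum>i<m. (b i x)\<^sup>2)" if x: "x \<in> F" for x
  proof -
    define c where "c = (\<lambda>i. \<Sum>y\<in>F. g x y * b i y)"
    have gx: "g x z = (\<Sum>i<m. c i * b i z)" if "z \<in> F" for z
      unfolding c_def by (rule expand[OF g[OF x] that])
    have "(\<Sum>y\<in>F. (g x y)\<^sup>2) = (\<Sum>y\<in>F. \<Sum>i<m. c i * (g x y * b i y))"
    proof (intro sum.cong refl)
      fix y assume "y \<in> F"
      then have "(g x y)\<^sup>2 = g x y * (\<Sum>i<m. c i * b i y)"
        using gx[of y] by (simp add: power2_eq_square)
      then show "(g x y)\<^sup>2 = (\<Sum>i<m. c i * (g x y * b i y))"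
        by (simp add: sum_distrib_left mult.left_commute)
    qed
    also have "\<dots> = (\<Sum>i<m. \<Sum>y\<in>F. c i * (g x y * b i y))"
      by (rule sum.swap)
    also have "\<dots> = (\<Sum>i<m. (c i)\<^sup>2)"
      by (simp add: power2_eq_square c_def flip: sum_distrib_left)
    finally have c: "(\<Sum>i<m. (c i)\<^sup>2) \<le> C" using bound[OF x] by simp
    have "(g x x)\<^sup>2 \<le> (\<Sum>i<m. (c i)\<^sup>2) * (\<Sum>i<m. (b i x)\<^sup>2)"
      unfolding gx[OF x] by (rule Cauchy_Schwarz_ineq_sum)
    also have "\<dots> \<le> C * (\<Sum>i<m. (b i x)\<^sup>2)"
      by (intro mult_right_mono c sum_nonneg) auto
    finally show ?thesis .
  qed
  have "(\<Sum>x\<in>F. (g x x)\<^sup>2) \<le> (\<Sum>x\<in>F. C * (\<Sum>i<m. (b i x)\<^sup>2))"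
    by (intro sum_mono eval)
  also have "\<dots> = C * (\<Sum>i<m. \<Sum>x\<in>F. b i x * b i x)"
    by (simp add: power2_eq_square sum.swap[of _ "{..<m}" F] flip: sum_distrib_left)
  also have "\<dots> = C * m" by (simp add: orth)
  also have "\<dots> \<le> C * card S" using m C by (intro mult_left_mono) auto
  finally show ?thesis .
qed

text \<open>
  On a box of \<open>n\<^sup>2\<close> cells the functions in \<open>K\<close> are determined by their values on the \<open>2 * n\<close> cells along
  its left and lower sides. If \<open>f (c, i, j)\<close> is not zero, the translates of \<open>f\<close> supply, for each of the
  \<open>n\<^sup>2\<close> cells, a function in \<open>K\<close> with this same value there and with norm bounded independently of
  \<open>n\<close>. By \<open>sum_diagonal_squares_le\<close>, \<open>n\<^sup>2\<close> is then bounded by a constant multiple of \<open>n\<close>.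
\<close>

theorem corner_determined_imp_square_summable_zero:
  fixes K :: "('c::finite \<times> int \<times> int \<Rightarrow> real) set"
  assumes lin: "\<And>f g a b. f \<in> K \<Longrightarrow> g \<in> K \<Longrightarrow> (\<lambda>x. a * f x + b * g x) \<in> K"
    and shift: "\<And>f k l. f \<in> K \<Longrightarrow> (\<lambda>(c, i, j). f (c, i + k, j + l)) \<in> K"
    and corner: "\<And>f c. f \<in> K \<Longrightarrow> \<forall>d. f (d, -1, 0) = 0 \<and> f (d, 0, -1) = 0 \<Longrightarrow> f (c, 0, 0) = 0"
    and f: "f \<in> K" and summable: "square_summable (\<lambda>(i, j). f (c, i, j))"
  shows "f (c, i, j) = 0"
proof (rule ccontr)
  assume nz: "f (c, i, j) \<noteq> 0"
  have step: "v (d, k, l) = 0"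
    if v: "v \<in> K" and "\<forall>d. v (d, k - 1, l) = 0" and "\<forall>d. v (d, k, l - 1) = 0" for v d k l
    using corner[OF shift[OF v, of k l], of d] that by (simp add: add.commute)
  have quadrant: "v (d, int k, int l) = 0"
    if v: "v \<in> K" and left: "\<And>d b. b < n \<Longrightarrow> v (d, -1, int b) = 0"
      and below: "\<And>d a. a < n \<Longrightarrow> v (d, int a, -1) = 0" and "k < n" "l < n" for v d k l n
    using that(4,5)
  proof (induction "k + l" arbitrary: d k l rule: less_induct)
    case less
    have "v (d', int k - 1, int l) = 0" for d'
      using less.hyps[of "k - 1" l d'] less.prems left[of l d'] by (cases k) auto
    moreover have "v (d', int k, int l - 1) = 0" for d'
      using less.hyps[of k "l - 1" d'] less.prems below[of k d'] by (cases l) auto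
    ultimately show ?case by (intro step[OF v]) auto
  qed
  define C where "C = infsum (\<lambda>(i, j). (f (c, i, j))\<^sup>2) UNIV"
  have sums: "(\<lambda>(i, j). (f (c, i, j))\<^sup>2) summable_on UNIV"
    using summable by (simp add: square_summable_def case_prod_unfold)
  have C: "0 \<le> C" unfolding C_def by (rule infsum_nonneg) auto
  have box: "(f (c, i, j))\<^sup>2 * (real n)\<^sup>2 \<le> C * (2 * real CARD('c) * real n)" for n
  proof -
    \<comment> \<open>\<open>G (c, k, l)\<close> is the translate of \<open>f\<close> that takes the value \<open>f (c, i, j)\<close> at \<open>(c, k, l)\<close>\<close>
    define G where "G = (\<lambda>x :: 'c \<times> int \<times> int.
      \<lambda>(d, a, b). f (d, a + (i - fst (snd x)), b + (j - snd (snd x))))"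
    define B :: "(int \<times> int) set" where "B = (int ` {..<n}) \<times> (int ` {..<n})"
    define E :: "(int \<times> int) set" where "E = {-1} \<times> int ` {..<n} \<union> int ` {..<n} \<times> {-1}"
    have cardE: "card E \<le> 2 * n" unfolding E_def
      by (rule order_trans[OF card_Un_le]) (simp add: card_cartesian_product card_image)
    have "(\<Sum>x\<in>{c} \<times> B. (G x x)\<^sup>2)
        \<le> C * card ((UNIV :: 'c set) \<times> E)"
    proof (rule sum_diagonal_squares_le[where K = K and g = G])
      fix x assume x: "x \<in> {c} \<times> B"
      obtain k l where kl: "x = (c, k, l)" using x by auto
      show "G x \<in> K"
        using shift[OF f, of "i - k" "j - l"] by (simp add: kl G_def)
      have "(\<Sum>y\<in>{c} \<times> B. (G x y)\<^sup>2)
          = (\<Sum>(a, b)\<in>(\<lambda>(a, b). (a + (i - k), b + (j - l))) ` B. (f (c, a, b))\<^sup>2)"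
        by (rule sum.reindex_bij_witness[of _ "\<lambda>(a, b). (c, a - (i - k), b - (j - l))"
              "\<lambda>(_, a, b). (a + (i - k), b + (j - l))"])
           (auto simp: G_def kl)
      also have "\<dots> \<le> C" unfolding C_def
        by (rule finite_sum_le_infsum[OF sums]) (auto simp: B_def)
      finally show "(\<Sum>y\<in>{c} \<times> B. (G x y)\<^sup>2) \<le> C" .
    next
      fix v x assume "v \<in> K" "\<forall>s\<in>UNIV \<times> E. v s = 0" "x \<in> {c} \<times> B"
      then show "v x = 0"
        by (auto simp: B_def E_def intro!: quadrant[of v n])
    qed (use lin C in \<open>auto simp: B_def E_def\<close>)
    also have "(\<Sum>x\<in>{c} \<times> B. (G x x)\<^sup>2)
        = (\<Sum>x\<in>{c} \<times> B. (f (c, i, j))\<^sup>2)"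
      by (intro sum.cong) (auto simp: G_def)
    also have "\<dots> = (f (c, i, j))\<^sup>2 * (real n)\<^sup>2"
      by (simp add: B_def card_cartesian_product card_image power2_eq_square)
    also have "C * card ((UNIV :: 'c set) \<times> E) \<le> C * (2 * real CARD('c) * real n)"
    proof (rule mult_left_mono[OF _ C])
      have "card ((UNIV :: 'c set) \<times> E) \<le> CARD('c) * (2 * n)"
        using cardE by (simp add: card_cartesian_product)
      then have "real (card ((UNIV :: 'c set) \<times> E)) \<le> real (CARD('c) * (2 * n))"
        by (rule of_nat_mono)
      then show "real (card ((UNIV :: 'c set) \<times> E)) \<le> 2 * real CARD('c) * real n" by simp
    qed
    finally show ?thesis .
  qed
  have pos: "(f (c, i, j))\<^sup>2 > 0" using nz by simp
  obtain n where n: "C * (2 * real CARD('c)) < real n * (f (c, i, j))\<^sup>2"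
    using reals_Archimedean3[OF pos] by blast
  have "0 \<le> C * (2 * real CARD('c))" using C by simp
  then have "n > 0" using n by (cases n) auto
  then have "C * (2 * real CARD('c)) * real n < real n * (f (c, i, j))\<^sup>2 * real n"
    using n by (simp add: mult.commute)
  then show False using box[of n] by (simp add: power2_eq_square mult_ac)
qed

section \<open>Algebraic independence and rational polynomials\<close>

definition monomial_value :: "('i \<Rightarrow> real) \<Rightarrow> ('i \<Rightarrow>\<^sub>0 nat) \<Rightarrow> real" where
  "monomial_value a m = (\<Prod>i\<in>Poly_Mapping.keys m. a i ^ Poly_Mapping.lookup m i)"

lemma monomial_value_add: "monomial_value a (m + n) = monomial_value a m * monomial_value a n"
proof -
  let ?U = "Poly_Mapping.keys m \<union> Poly_Mapping.keys n"
  have extend: "monomial_value a k = (\<Prod>i\<in>?U. a i ^ Poly_Mapping.lookup k i)"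
    if "Poly_Mapping.keys k \<subseteq> ?U" for k
    unfolding monomial_value_def
    by (rule prod.mono_neutral_left) (use that in \<open>auto simp: in_keys_iff\<close>)
  show ?thesis
    using Poly_Mapping.keys_add[of m n]
    by (simp add: extend lookup_add power_add prod.distrib)
qed

lemma poly_eval_single: "poly_eval a (Poly_Mapping.single m c) = of_rat c * monomial_value a m"
  by (cases "c = 0") (auto simp: poly_eval_def monomial_value_def)

lemma poly_eval_add: "poly_eval a (P + Q) = poly_eval a P + poly_eval a Q"
  unfolding poly_eval_def
  by (rule setsum_keys_plus_distrib) (auto simp: of_rat_add algebra_simps)

lemma poly_eval_sum: "poly_eval a (\<Sum>x\<in>A. P x) = (\<Sum>x\<in>A. poly_eval a (P x))"
proof -
  have "poly_eval a 0 = 0" by (simp add: poly_eval_def)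
  then show ?thesis
    by (induction A rule: infinite_finite_induct) (auto simp: poly_eval_add)
qed

lemma sum_single_keys: "(\<Sum>m\<in>Poly_Mapping.keys P. Poly_Mapping.single m (Poly_Mapping.lookup P m)) = P"
  by (rule poly_mapping_eqI) (auto simp: lookup_sum lookup_single when_def in_keys_iff)

lemma poly_eval_mult: "poly_eval a (P * Q) = poly_eval a P * poly_eval a Q"
proof -
  have "poly_eval a (P * Q) = poly_eval a
      ((\<Sum>m\<in>Poly_Mapping.keys P. Poly_Mapping.single m (Poly_Mapping.lookup P m)) *
       (\<Sum>n\<in>Poly_Mapping.keys Q. Poly_Mapping.single n (Poly_Mapping.lookup Q n)))"
    by (simp only: sum_single_keys)
  also have "\<dots> = (\<Sum>m\<in>Poly_Mapping.keys P. of_rat (Poly_Mapping.lookup P m) * monomial_value a m) *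
      (\<Sum>n\<in>Poly_Mapping.keys Q. of_rat (Poly_Mapping.lookup Q n) * monomial_value a n)"
    by (simp add: sum_product poly_eval_sum mult_single poly_eval_single monomial_value_add
        of_rat_mult mult_ac)
  finally show ?thesis by (simp add: poly_eval_def monomial_value_def)
qed

definition rational_polynomial :: "(('i \<Rightarrow> real) \<Rightarrow> real) \<Rightarrow> bool" where
  "rational_polynomial f \<longleftrightarrow> (\<exists>P. \<forall>a. poly_eval a P = f a)"

lemma rational_polynomial_of_int: "rational_polynomial (\<lambda>a. of_int c)"
  unfolding rational_polynomial_def
  by (rule exI[of _ "Poly_Mapping.single 0 (of_int c)"])
     (simp add: poly_eval_single monomial_value_def del: single_of_int)

lemma rational_polynomial_var: "rational_polynomial (\<lambda>a. a i)"
  unfolding rational_polynomial_def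
  by (rule exI[of _ "Poly_Mapping.single (Poly_Mapping.single i 1) 1"])
     (simp add: poly_eval_single monomial_value_def)

lemma rational_polynomial_add:
  assumes "rational_polynomial f" "rational_polynomial g"
  shows "rational_polynomial (\<lambda>a. f a + g a)"
  using assms unfolding rational_polynomial_def by (metis poly_eval_add)

lemma rational_polynomial_mult:
  assumes "rational_polynomial f" "rational_polynomial g"
  shows "rational_polynomial (\<lambda>a. f a * g a)"
  using assms unfolding rational_polynomial_def by (metis poly_eval_mult)

lemma rational_polynomial_diff:
  assumes "rational_polynomial f" "rational_polynomial g"
  shows "rational_polynomial (\<lambda>a. f a - g a)"
  using rational_polynomial_add[OF assms(1)
      rational_polynomial_mult[OF rational_polynomial_of_int[of "-1"] assms(2)]] by simp

text \<open>
  A polynomial that vanishes at an algebraically independent point is the zero polynomial, hence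
  vanishes everywhere. One convenient point \<open>b\<close> with \<open>f b \<noteq> 0\<close> therefore certifies that \<open>f\<close> does
  not vanish at any algebraically independent point.
\<close>

lemma algebraically_independent_nonzero:
  assumes "algebraically_independent a" "rational_polynomial f" "f b \<noteq> 0"
  shows "f a \<noteq> 0"
proof
  assume "f a = 0"
  obtain P where P: "\<And>a. poly_eval a P = f a"
    using assms(2) unfolding rational_polynomial_def by blast
  have "P = 0" using assms(1) \<open>f a = 0\<close> P by (metis algebraically_independent_def)
  then have "f b = 0" using P[of b] by (simp add: poly_eval_def)
  then show False using assms(3) by simp
qed

section \<open>The motif and its symbol function\<close>

lemma exhaust_8:
  fixes e :: 8
  shows "e = 1 \<or> e = 2 \<or> e = 3 \<or> e = 4 \<or> e = 5 \<or> e = 6 \<or> e = 7 \<or> e = 8"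
proof (induct e)
  case (of_int z)
  then have "z = 0 \<or> z = 1 \<or> z = 2 \<or> z = 3 \<or> z = 4 \<or> z = 5 \<or> z = 6 \<or> z = 7" by fastforce
  then show ?case by auto
qed

lemma forall_8:
  "(\<forall>e::8. P e) \<longleftrightarrow> P 1 \<and> P 2 \<and> P 3 \<and> P 4 \<and> P 5 \<and> P 6 \<and> P 7 \<and> P 8"
  by (metis exhaust_8)

lemma vector_8:
  "(vector [a1, a2, a3, a4, a5, a6, a7, a8] :: 'a::zero^8) $ 1 = a1"
  "(vector [a1, a2, a3, a4, a5, a6, a7, a8] :: 'a::zero^8) $ 2 = a2"
  "(vector [a1, a2, a3, a4, a5, a6, a7, a8] :: 'a::zero^8) $ 3 = a3"
  "(vector [a1, a2, a3, a4, a5, a6, a7, a8] :: 'a::zero^8) $ 4 = a4"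
  "(vector [a1, a2, a3, a4, a5, a6, a7, a8] :: 'a::zero^8) $ 5 = a5"
  "(vector [a1, a2, a3, a4, a5, a6, a7, a8] :: 'a::zero^8) $ 6 = a6"
  "(vector [a1, a2, a3, a4, a5, a6, a7, a8] :: 'a::zero^8) $ 7 = a7"
  "(vector [a1, a2, a3, a4, a5, a6, a7, a8] :: 'a::zero^8) $ 8 = a8"
  unfolding vector_def by simp_all

lemma motif_edges_nth:
  "motif_edges $ 1 = (1, 2, 0, 0)"
  "motif_edges $ 2 = (2, 3, 0, 0)"
  "motif_edges $ 3 = (3, 4, 0, 0)"
  "motif_edges $ 4 = (4, 1, 0, 0)"
  "motif_edges $ 5 = (1, 2, -1, 0)"
  "motif_edges $ 6 = (2, 3, 0, -1)"
  "motif_edges $ 7 = (3, 4, 1, 0)"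
  "motif_edges $ 8 = (4, 1, 0, 1)"
  by (simp_all only: motif_edges_def vector_8)

lemma grid_symbol_entries:
  fixes x y :: "4 \<Rightarrow> real" and p :: "4 \<Rightarrow> real^2"
  assumes p: "\<And>i. p i = vector [x i, y i]"
    and z: "z \<in> sphere 0 1" and w: "w \<in> sphere 0 1"
  defines "X \<equiv> (\<lambda>i j. complex_of_real (x i - x j))" and "Y \<equiv> (\<lambda>i j. complex_of_real (y i - y j))"
  shows "grid_symbol p z w = vector
        [vector [X 1 2, Y 1 2, - X 1 2, - Y 1 2, 0, 0, 0, 0],
         vector [0, 0, X 2 3, Y 2 3, - X 2 3, - Y 2 3, 0, 0],
         vector [0, 0, 0, 0, X 3 4, Y 3 4, - X 3 4, - Y 3 4],
         vector [- X 4 1, - Y 4 1, 0, 0, 0, 0, X 4 1, Y 4 1],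
         vector [X 1 2 + 1, Y 1 2, - (X 1 2 + 1) * z, - Y 1 2 * z, 0, 0, 0, 0],
         vector [0, 0, X 2 3, Y 2 3 + 1, - X 2 3 * w, - (Y 2 3 + 1) * w, 0, 0],
         vector [0, 0, 0, 0, X 3 4 - 1, Y 3 4, (1 - X 3 4) * cnj z, - Y 3 4 * cnj z],
         vector [- X 4 1 * cnj w, (1 - Y 4 1) * cnj w, 0, 0, 0, 0, X 4 1, Y 4 1 - 1]]"
proof -
  \<comment> \<open>turns the negative powers of the conjugates in rows 5 and 6 into \<open>z\<close> and \<open>w\<close>\<close>
  have unit: "inverse (cnj v) = v" if "v \<in> sphere 0 1" for v :: complex
  proof -
    have "v * cnj v = 1" using that by (simp add: complex_norm_square[symmetric])
    then show ?thesis by (metis inverse_unique mult.commute)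
  qed
  have columns: "symbol_column $ 1 = (1, 1)" "symbol_column $ 2 = (1, 2)"
    "symbol_column $ 3 = (2, 1)" "symbol_column $ 4 = (2, 2)"
    "symbol_column $ 5 = (3, 1)" "symbol_column $ 6 = (3, 2)"
    "symbol_column $ 7 = (4, 1)" "symbol_column $ 8 = (4, 2)"
    by (simp_all only: symbol_column_def vector_8)
  show ?thesis
    unfolding vec_eq_iff forall_8 vector_8 grid_symbol_def
    by (simp add: vector_8 motif_edges_nth columns p power_int_minus
        unit[OF z] unit[OF w] X_def Y_def algebra_simps)
qed

section \<open>Edge directions of the quadrilateral grid\<close>

definition motif_edge_vector :: "(4 \<Rightarrow> real^2) \<Rightarrow> 8 \<Rightarrow> real^2" where
  "motif_edge_vector p e =
     (let (s, t, i, j) = motif_edges $ e in p s - p t - vector [of_int i, of_int j])"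

definition cross :: "real^2 \<Rightarrow> real^2 \<Rightarrow> real" where
  "cross v w = v $ 1 * w $ 2 - v $ 2 * w $ 1"

lemma orthogonal_to_both_imp_zero:
  assumes "cross v w \<noteq> 0" "v \<bullet> u = 0" "w \<bullet> u = 0"
  shows "u = 0"
proof -
  have dots: "v $ 1 * u $ 1 + v $ 2 * u $ 2 = 0" "w $ 1 * u $ 1 + w $ 2 * u $ 2 = 0"
    using assms by (auto simp: inner_vec_def sum_2)
  have "cross v w * u $ 1 = w $ 2 * (v $ 1 * u $ 1 + v $ 2 * u $ 2) - v $ 2 * (w $ 1 * u $ 1 + w $ 2 * u $ 2)"
    "cross v w * u $ 2 = v $ 1 * (w $ 1 * u $ 1 + w $ 2 * u $ 2) - w $ 1 * (v $ 1 * u $ 1 + v $ 2 * u $ 2)"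
    by (auto simp: cross_def algebra_simps)
  then show ?thesis using assms(1) dots by (auto simp: vec_eq_iff forall_2)
qed

lemma scaleR_combination_eq_zero:
  assumes "cross v w \<noteq> 0" "a *\<^sub>R v + b *\<^sub>R w = 0"
  shows "a = 0" "b = 0"
proof -
  have eqs: "a * v $ 1 + b * w $ 1 = 0" "a * v $ 2 + b * w $ 2 = 0"
    using assms(2) by (auto simp: vec_eq_iff forall_2)
  have "cross v w * a = w $ 2 * (a * v $ 1 + b * w $ 1) - w $ 1 * (a * v $ 2 + b * w $ 2)"
    "cross v w * b = v $ 1 * (a * v $ 2 + b * w $ 2) - v $ 2 * (a * v $ 1 + b * w $ 1)"
    by (auto simp: cross_def algebra_simps)
  then show "a = 0" "b = 0" using assms(1) eqs by auto
qed


text \<open>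
  The motif whose grid is the square grid of mesh 1/2. It serves as the test point in
  \<open>algebraically_independent_nonzero\<close>: here every edge is exactly horizontal or exactly vertical.
\<close>

definition square_motif :: "4 \<Rightarrow> real^2" where
  "square_motif t = vector [if t \<in> {2, 3} then 1 / 2 else 0, if t \<in> {3, 4} then 1 / 2 else 0]"

lemma square_motif_edge_vectors:
  "motif_edge_vector square_motif 1 = vector [- 1 / 2, 0]"
  "motif_edge_vector square_motif 2 = vector [0, - 1 / 2]"
  "motif_edge_vector square_motif 3 = vector [1 / 2, 0]"
  "motif_edge_vector square_motif 4 = vector [0, 1 / 2]"
  "motif_edge_vector square_motif 5 = vector [1 / 2, 0]"
  "motif_edge_vector square_motif 6 = vector [0, 1 / 2]"
  "motif_edge_vector square_motif 7 = vector [- 1 / 2, 0]"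
  "motif_edge_vector square_motif 8 = vector [0, - 1 / 2]"
  by (simp_all add: motif_edge_vector_def motif_edges_nth square_motif_def vec_eq_iff forall_2)

text \<open>
  The cross product of two edge vectors is a polynomial with integer coefficients in the coordinates
  of the motif vertices, so that edges which are not parallel in the square grid are not parallel in
  a grid with algebraically independent coordinates.
\<close>

lemma cross_motif_edges_nonzero:
  assumes indep: "algebraically_independent (\<lambda>(i, k). p i $ k)"
    and square: "cross (motif_edge_vector square_motif e) (motif_edge_vector square_motif e') \<noteq> 0"
  shows "cross (motif_edge_vector p e) (motif_edge_vector p e') \<noteq> 0"
proof -
  define placement :: "(4 \<times> 2 \<Rightarrow> real) \<Rightarrow> 4 \<Rightarrow> real^2" where
    "placement = (\<lambda>a t. \<chi> k. a (t, k))"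
  have placement: "placement (\<lambda>(i, k). q i $ k) = q" for q
    by (auto simp: placement_def vec_eq_iff)
  have entry: "rational_polynomial (\<lambda>a. motif_edge_vector (placement a) e $ k)" for e k
  proof -
    obtain s t i j where st: "motif_edges $ e = (s, t, i, j)" by (metis prod_cases4)
    have "(\<lambda>a. motif_edge_vector (placement a) e $ k)
        = (\<lambda>a. a (s, k) - a (t, k) - of_int (if k = 1 then i else j))"
      using exhaust_2[of k] by (auto simp: motif_edge_vector_def st placement_def)
    then show ?thesis
      by (simp only:) (intro rational_polynomial_diff rational_polynomial_var
          rational_polynomial_of_int)
  qed
  have poly: "rational_polynomial
      (\<lambda>a. cross (motif_edge_vector (placement a) e) (motif_edge_vector (placement a) e'))"
    unfolding cross_def by (intro rational_polynomial_diff rational_polynomial_mult entry)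
  show ?thesis
    using algebraically_independent_nonzero[OF indep poly, of "\<lambda>(i, k). square_motif i $ k"] square
    by (simp add: placement)
qed

lemma grid_point_diff:
  "grid_point p (s, k, l) - grid_point p (t, i + k, j + l) = p s - p t - vector [of_int i, of_int j]"
  "grid_point p (t, i + k, j + l) - grid_point p (s, k, l) = - (p s - p t - vector [of_int i, of_int j])"
  by (simp_all add: grid_point_def vec_eq_iff forall_2)

text \<open>
  Edge equations are translation invariant: they involve only the motif edge vectors.
\<close>

lemma rigidity_map_grid:
  "rigidity_map (grid_point p) grid_ends u (e, k, l) =
     (let (s, t, i, j) = motif_edges $ e in
        motif_edge_vector p e \<bullet> (u (s, k, l) - u (t, i + k, j + l)))"
  by (simp add: rigidity_map_def grid_ends_def grid_point_diff motif_edge_vector_def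
      split: prod.splits)

lemma rigidity_block_grid:
  "rigidity_block (grid_point p) grid_ends (e, k, l) v =
     (let (s, t, i, j) = motif_edges $ e in
        if v = (s, k, l) then motif_edge_vector p e
        else if v = (t, i + k, j + l) then - motif_edge_vector p e else 0)"
  by (simp add: rigidity_block_def grid_ends_def grid_point_diff motif_edge_vector_def
      split: prod.splits)

text \<open>
  Combinatorially, every vertex has one edge to the right, one to the left, one above and one below.
  Around \<open>p\<^sub>1\<close>, for example, the edges 1, 4, 5, 8 lead to the right, up, to the left and down.
\<close>

lemma incident_grid_edges:
  "{e. incident grid_ends (1, k, l) e} = {(1, k, l), (4, k, l), (5, k, l), (8, k, l - 1)}"
  "{e. incident grid_ends (2, k, l) e} = {(1, k, l), (2, k, l), (6, k, l), (5, k + 1, l)}"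
  "{e. incident grid_ends (3, k, l) e} = {(2, k, l), (3, k, l), (7, k, l), (6, k, l + 1)}"
  "{e. incident grid_ends (4, k, l) e} = {(3, k, l), (4, k, l), (8, k, l), (7, k - 1, l)}"
proof -
  have "incident grid_ends v (e, k', l') \<longleftrightarrow> (case motif_edges $ e of (s, t, i, j) \<Rightarrow>
      v = (s, k', l') \<or> v = (t, i + k', j + l'))" for v e k' l'
    by (auto simp: incident_def grid_ends_def split: prod.splits)
  then have all: "{x. incident grid_ends v x} = A \<longleftrightarrow> (\<forall>e k' l'. (case motif_edges $ e of (s, t, i, j) \<Rightarrow>
      v = (s, k', l') \<or> v = (t, i + k', j + l')) \<longleftrightarrow> (e, k', l') \<in> A)" for v A
    by (auto simp: set_eq_iff)
  show "{e. incident grid_ends (1, k, l) e} = {(1, k, l), (4, k, l), (5, k, l), (8, k, l - 1)}"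
    "{e. incident grid_ends (2, k, l) e} = {(1, k, l), (2, k, l), (6, k, l), (5, k + 1, l)}"
    "{e. incident grid_ends (3, k, l) e} = {(2, k, l), (3, k, l), (7, k, l), (6, k, l + 1)}"
    "{e. incident grid_ends (4, k, l) e} = {(3, k, l), (4, k, l), (8, k, l), (7, k - 1, l)}"
    unfolding all forall_8 by (auto simp: motif_edges_nth)
qed

lemma rigidity_transpose_grid:
  fixes p :: "4 \<Rightarrow> real^2"
  defines "d \<equiv> motif_edge_vector p" and "R \<equiv> rigidity_transpose (grid_point p) grid_ends"
  shows "R s (1, k, l) = s (1, k, l) *\<^sub>R d 1 - s (4, k, l) *\<^sub>R d 4 + s (5, k, l) *\<^sub>R d 5 - s (8, k, l - 1) *\<^sub>R d 8"
    "R s (2, k, l) = s (2, k, l) *\<^sub>R d 2 - s (1, k, l) *\<^sub>R d 1 + s (6, k, l) *\<^sub>R d 6 - s (5, k + 1, l) *\<^sub>R d 5"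
    "R s (3, k, l) = s (3, k, l) *\<^sub>R d 3 - s (2, k, l) *\<^sub>R d 2 + s (7, k, l) *\<^sub>R d 7 - s (6, k, l + 1) *\<^sub>R d 6"
    "R s (4, k, l) = s (4, k, l) *\<^sub>R d 4 - s (3, k, l) *\<^sub>R d 3 + s (8, k, l) *\<^sub>R d 8 - s (7, k - 1, l) *\<^sub>R d 7"
  by (simp_all add: R_def d_def rigidity_transpose_def incident_grid_edges rigidity_block_grid
      motif_edges_nth algebra_simps)


text \<open>
  The first four pairs are the left and the lower edge at \<open>p\<^sub>1\<close>, \<open>p\<^sub>2\<close>, \<open>p\<^sub>4\<close>, \<open>p\<^sub>3\<close>; they let a flex
  propagate. The last four are the right and the upper edge at \<open>p\<^sub>1\<close>, \<open>p\<^sub>2\<close>, \<open>p\<^sub>4\<close>, \<open>p\<^sub>3\<close>, up to order;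
  they let a stress propagate.
\<close>

lemma cross_motif_edges_at_vertices:
  fixes p :: "4 \<Rightarrow> real^2"
  defines "d \<equiv> motif_edge_vector p"
  assumes "algebraically_independent (\<lambda>(i, k). p i $ k)"
  shows "cross (d 5) (d 8) \<noteq> 0" "cross (d 1) (d 6) \<noteq> 0" "cross (d 7) (d 4) \<noteq> 0" "cross (d 3) (d 2) \<noteq> 0"
    "cross (d 1) (d 4) \<noteq> 0" "cross (d 2) (d 5) \<noteq> 0" "cross (d 3) (d 8) \<noteq> 0" "cross (d 7) (d 6) \<noteq> 0"
  unfolding d_def
  by (rule cross_motif_edges_nonzero[OF assms(2)], simp add: square_motif_edge_vectors cross_def)+

section \<open>Square-summable flexes and stresses\<close>

text \<open>
  Flexes as scalar functions on cells, one for each motif vertex and coordinate, which is the form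
  that \<open>corner_determined_imp_square_summable_zero\<close> asks for.
\<close>

definition infinitesimal_flexes :: "(4 \<Rightarrow> real^2) \<Rightarrow> ((4 \<times> 2) \<times> int \<times> int \<Rightarrow> real) set" where
  "infinitesimal_flexes p =
     {f. rigidity_map (grid_point p) grid_ends (\<lambda>(t, i, j). \<chi> c. f ((t, c), i, j)) = (\<lambda>_. 0)}"

lemma mem_infinitesimal_flexes:
  "f \<in> infinitesimal_flexes p \<longleftrightarrow> (\<forall>e k l. let (s, t, i, j) = motif_edges $ e in
     motif_edge_vector p e \<bullet> ((\<chi> c. f ((s, c), k, l)) - (\<chi> c. f ((t, c), i + k, j + l))) = 0)"
  by (simp add: infinitesimal_flexes_def fun_eq_iff rigidity_map_grid split: prod.splits)

text \<open>
  If the left and the lower neighbour of a vertex have velocity zero, the two edges to them force the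
  velocity of the vertex to be orthogonal to two independent directions, hence to be zero. So the velocities in a cell
  are determined by those in the cells to its left and below it.
\<close>

lemma square_summable_flex_eq_zero:
  assumes indep: "algebraically_independent (\<lambda>(i, k). p i $ k)"
    and u: "square_summable u" and flex: "rigidity_map (grid_point p) grid_ends u = (\<lambda>_. 0)"
  shows "u = (\<lambda>_. 0)"
proof -
  define f where "f = (\<lambda>((t, c), i, j). u (t, i, j) $ c)"
  note cross = cross_motif_edges_at_vertices[OF indep]
  have "f (tc, i, j) = 0" for tc i j
  proof (rule corner_determined_imp_square_summable_zero[where K = "infinitesimal_flexes p"])
    fix g h a b assume "g \<in> infinitesimal_flexes p" "h \<in> infinitesimal_flexes p"
    moreover have "(\<chi> c. a * g ((t, c), k, l) + b * h ((t, c), k, l))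
        = a *\<^sub>R (\<chi> c. g ((t, c), k, l)) + b *\<^sub>R (\<chi> c. h ((t, c), k, l))" for t k l
      by (simp add: vec_eq_iff)
    ultimately show "(\<lambda>x. a * g x + b * h x) \<in> infinitesimal_flexes p"
      by (simp add: mem_infinitesimal_flexes split: prod.splits)
        (simp add: inner_diff_right inner_add_right algebra_simps)
  next
    fix g k l assume g: "g \<in> infinitesimal_flexes p"
    then show "(\<lambda>(c, i, j). g (c, i + k, j + l)) \<in> infinitesimal_flexes p"
      by (simp add: mem_infinitesimal_flexes add.assoc split: prod.splits)
  next
    fix g :: "(4 \<times> 2) \<times> int \<times> int \<Rightarrow> real" and tc :: "4 \<times> 2"
    assume g: "g \<in> infinitesimal_flexes p" and zero: "\<forall>d. g (d, -1, 0) = 0 \<and> g (d, 0, -1) = 0"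
    define w where "w = (\<lambda>t k l. \<chi> c. g ((t, c), k, l))"
    have edge: "let (s, t, i, j) = motif_edges $ e in
        motif_edge_vector p e \<bullet> (w s k l - w t (i + k) (j + l)) = 0" for e k l
      using g unfolding mem_infinitesimal_flexes w_def by blast
    have prev: "w t (-1) 0 = 0" "w t 0 (-1) = 0" for t
      using zero by (auto simp: w_def vec_eq_iff)
    \<comment> \<open>each vertex follows its left and lower neighbours, hence the order 1, 2, 4, 3\<close>
    have w1: "w 1 0 0 = 0"
      by (rule orthogonal_to_both_imp_zero[OF cross(1)])
        (use edge[of 5 0 0] edge[of 8 0 "-1"] prev in \<open>auto simp: motif_edges_nth\<close>)
    have w2: "w 2 0 0 = 0"
      by (rule orthogonal_to_both_imp_zero[OF cross(2)])
        (use edge[of 1 0 0] edge[of 6 0 0] prev w1 in \<open>auto simp: motif_edges_nth\<close>)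
    have w4: "w 4 0 0 = 0"
      by (rule orthogonal_to_both_imp_zero[OF cross(3)])
        (use edge[of 7 "-1" 0] edge[of 4 0 0] prev w1 in \<open>auto simp: motif_edges_nth\<close>)
    have w3: "w 3 0 0 = 0"
      by (rule orthogonal_to_both_imp_zero[OF cross(4)])
        (use edge[of 3 0 0] edge[of 2 0 0] w2 w4 in \<open>auto simp: motif_edges_nth\<close>)
    obtain t c where tc: "tc = (t, c)" by force
    have "w t 0 0 = 0" using w1 w2 w3 w4 exhaust_4[of t] by auto
    then show "g (tc, 0, 0) = 0" by (simp add: w_def vec_eq_iff tc)
  next
    have "(\<lambda>(t, i, j). \<chi> c. f ((t, c), i, j)) = u" by (auto simp: f_def)
    then show "f \<in> infinitesimal_flexes p" using flex by (simp add: infinitesimal_flexes_def)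
    obtain t c where tc: "tc = (t, c)" by force
    have "(\<lambda>ij. (norm (u (t, ij)))\<^sup>2) summable_on UNIV"
    proof -
      have "(\<lambda>x. (norm (u x))\<^sup>2) summable_on (Pair t ` UNIV)"
        using u unfolding square_summable_def by (rule summable_on_subset_banach) auto
      then show ?thesis by (subst (asm) summable_on_reindex) (auto simp: inj_on_def o_def)
    qed
    then have "(\<lambda>(i, j). (f (tc, i, j))\<^sup>2) summable_on UNIV"
    proof (rule summable_on_comparison_test)
      fix ij :: "int \<times> int"
      have "\<bar>u (t, ij) $ c\<bar>\<^sup>2 \<le> (norm (u (t, ij)))\<^sup>2"
        by (intro power_mono component_le_norm_cart) auto
      then show "(case ij of (i, j) \<Rightarrow> (f (tc, i, j))\<^sup>2) \<le> (norm (u (t, ij)))\<^sup>2"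
        by (simp add: f_def tc split: prod.splits)
    qed (auto split: prod.splits)
    then show "square_summable (\<lambda>(i, j). f (tc, i, j))"
      by (simp add: square_summable_def case_prod_unfold)
  qed
  then show ?thesis by (auto simp: f_def vec_eq_iff fun_eq_iff)
qed

text \<open>
  If the left and the lower edge at a vertex carry no stress, the equilibrium there is a relation
  between the independent directions of the right and the upper edge, so that these carry no stress
  either. Stresses thus propagate from the left and from below, as velocities do.
\<close>

lemma square_summable_stress_eq_zero:
  assumes indep: "algebraically_independent (\<lambda>(i, k). p i $ k)"
    and s: "square_summable s" and stress: "rigidity_transpose (grid_point p) grid_ends s = (\<lambda>_. 0)"
  shows "s = (\<lambda>_. 0)"
proof -
  define K where "K = {s. rigidity_transpose (grid_point p) grid_ends s = (\<lambda>_. 0)}"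
  note cross = cross_motif_edges_at_vertices[OF indep]
  have "s (e, i, j) = 0" for e i j
  proof (rule corner_determined_imp_square_summable_zero[where K = K])
    fix g h a b assume gh: "g \<in> K" "h \<in> K"
    have "rigidity_transpose (grid_point p) grid_ends (\<lambda>x. a * g x + b * h x) v
        = a *\<^sub>R rigidity_transpose (grid_point p) grid_ends g v
          + b *\<^sub>R rigidity_transpose (grid_point p) grid_ends h v" for v
      by (simp add: rigidity_transpose_def scaleR_sum_right scaleR_left_distrib sum.distrib)
    then show "(\<lambda>x. a * g x + b * h x) \<in> K"
      using gh by (simp add: K_def fun_eq_iff)
  next
    fix g k l assume g: "g \<in> K"
    let ?R = "rigidity_transpose (grid_point p) grid_ends"
    have "?R (\<lambda>(c, i, j). g (c, i + k, j + l)) (t, i, j) = ?R g (t, i + k, j + l)" for t i j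
      using exhaust_4[of t] by (auto simp: rigidity_transpose_grid algebra_simps)
    then show "(\<lambda>(c, i, j). g (c, i + k, j + l)) \<in> K"
      using g by (simp add: K_def fun_eq_iff)
  next
    fix g e assume g: "g \<in> K"
      and zero: "\<forall>d. g (d, -1, 0) = 0 \<and> g (d, 0, -1) = 0"
    have eq: "rigidity_transpose (grid_point p) grid_ends g v = 0" for v
      using g fun_cong[of _ "\<lambda>_. 0" v] by (simp add: K_def)
    \<comment> \<open>Edges 5 and 6 of the cell enter it from the left and from below, so they are right or upper
      edges of vertices in the two preceding cells.\<close>
    have g5: "g (5, 0, 0) = 0"
      using scaleR_combination_eq_zero(2)[OF cross(6), of 0 "- g (5, 0, 0)"]
        eq[of "(2, -1, 0)"] zero
        by (simp add: rigidity_transpose_grid)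
    have g6: "g (6, 0, 0) = 0"
      using scaleR_combination_eq_zero(2)[OF cross(8), of 0 "- g (6, 0, 0)"]
        eq[of "(3, 0, -1)"] zero
        by (simp add: rigidity_transpose_grid)
    have g14: "g (1, 0, 0) = 0" "g (4, 0, 0) = 0"
      using scaleR_combination_eq_zero[OF cross(5), of "g (1, 0, 0)" "- g (4, 0, 0)"]
        eq[of "(1, 0, 0)"] zero g5
        by (simp_all add: rigidity_transpose_grid)
    have g2: "g (2, 0, 0) = 0"
      using scaleR_combination_eq_zero[OF cross(6), of "g (2, 0, 0)" "- g (5, 1, 0)"]
        eq[of "(2, 0, 0)"] g14 g6
        by (simp add: rigidity_transpose_grid)
    have g38: "g (3, 0, 0) = 0" "g (8, 0, 0) = 0"
      using scaleR_combination_eq_zero[OF cross(7), of "- g (3, 0, 0)" "g (8, 0, 0)"]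
        eq[of "(4, 0, 0)"] zero g14
        by (simp_all add: rigidity_transpose_grid)
    have g7: "g (7, 0, 0) = 0"
      using scaleR_combination_eq_zero[OF cross(8), of "g (7, 0, 0)" "- g (6, 0, 1)"]
        eq[of "(3, 0, 0)"] g2 g38
        by (simp add: rigidity_transpose_grid)
    show "g (e, 0, 0) = 0"
      using exhaust_8[of e] g5 g6 g14 g2 g38 g7 by auto
  next
    show "s \<in> K" using stress by (simp add: K_def)
    have "(\<lambda>x. (norm (s x))\<^sup>2) summable_on (Pair e ` UNIV)"
      using s unfolding square_summable_def by (rule summable_on_subset_banach) auto
    then show "square_summable (\<lambda>(i, j). s (e, i, j))"
      by (subst (asm) summable_on_reindex) (auto simp: inj_on_def o_def square_summable_def case_prod_unfold)
  qed
  then show ?thesis by (auto simp: fun_eq_iff)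
qed

section \<open>The symbol and square-summable isostaticity\<close>

theorem proposition5p5:
  fixes x y :: "4 \<Rightarrow> real" and p :: "4 \<Rightarrow> real^2"
  assumes p: "\<And>i. p i = vector [x i, y i]"
    and unit_cell: "\<And>i. x i \<in> {0..<1} \<and> y i \<in> {0..<1}"
  shows "(\<forall>z\<in>sphere 0 1. \<forall>w\<in>sphere 0 1.
      let X = (\<lambda>i j. complex_of_real (x i - x j));
          Y = (\<lambda>i j. complex_of_real (y i - y j))
      in grid_symbol p z w = vector
        [vector [X 1 2, Y 1 2, - X 1 2, - Y 1 2, 0, 0, 0, 0],
         vector [0, 0, X 2 3, Y 2 3, - X 2 3, - Y 2 3, 0, 0],
         vector [0, 0, 0, 0, X 3 4, Y 3 4, - X 3 4, - Y 3 4],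
         vector [- X 4 1, - Y 4 1, 0, 0, 0, 0, X 4 1, Y 4 1],
         vector [X 1 2 + 1, Y 1 2, - (X 1 2 + 1) * z, - Y 1 2 * z, 0, 0, 0, 0],
         vector [0, 0, X 2 3, Y 2 3 + 1, - X 2 3 * w, - (Y 2 3 + 1) * w, 0, 0],
         vector [0, 0, 0, 0, X 3 4 - 1, Y 3 4, (1 - X 3 4) * cnj z, - Y 3 4 * cnj z],
         vector [- X 4 1 * cnj w, (1 - Y 4 1) * cnj w, 0, 0, 0, 0, X 4 1, Y 4 1 - 1]])
    \<and> (algebraically_independent (\<lambda>(i, k). p i $ k) \<longrightarrow>
         square_summably_isostatic (grid_point p) grid_ends)"
proof (intro conjI ballI impI)
  fix z w :: complex
  assume "z \<in> sphere 0 1" "w \<in> sphere 0 1"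
  then show "let X = (\<lambda>i j. complex_of_real (x i - x j));
          Y = (\<lambda>i j. complex_of_real (y i - y j))
      in grid_symbol p z w = vector
        [vector [X 1 2, Y 1 2, - X 1 2, - Y 1 2, 0, 0, 0, 0],
         vector [0, 0, X 2 3, Y 2 3, - X 2 3, - Y 2 3, 0, 0],
         vector [0, 0, 0, 0, X 3 4, Y 3 4, - X 3 4, - Y 3 4],
         vector [- X 4 1, - Y 4 1, 0, 0, 0, 0, X 4 1, Y 4 1],
         vector [X 1 2 + 1, Y 1 2, - (X 1 2 + 1) * z, - Y 1 2 * z, 0, 0, 0, 0],
         vector [0, 0, X 2 3, Y 2 3 + 1, - X 2 3 * w, - (Y 2 3 + 1) * w, 0, 0],
         vector [0, 0, 0, 0, X 3 4 - 1, Y 3 4, (1 - X 3 4) * cnj z, - Y 3 4 * cnj z],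
         vector [- X 4 1 * cnj w, (1 - Y 4 1) * cnj w, 0, 0, 0, 0, X 4 1, Y 4 1 - 1]]"
    unfolding Let_def by (rule grid_symbol_entries[OF p])
next
  assume "algebraically_independent (\<lambda>(i, k). p i $ k)"
  then show "square_summably_isostatic (grid_point p) grid_ends"
    unfolding square_summably_isostatic_def
    using square_summable_flex_eq_zero square_summable_stress_eq_zero by blast
qed

end
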